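(* Let $K$ be a compact metrizable space with finitely many accumulation points. Then the closed unit ball $B_{C(K)}$ of $C(K)$ is plastic, i.e. every non-expansive bijection $F:B_{C(K)}\to B_{C(K)}$ is an isometry.
   Context: $C(K)$ denotes the Banach space of real-valued continuous functions on $K$ with the supremum norm, and $B_{C(K)}$ its closed unit ball with the metric induced by the norm. A map $F$ between metric spaces is non-expansive if it is $1$-Lipschitz. A metric space $M$ is plastic if every non-expansive bijection $F:M\to M$ is an isometry. *)

theory Defs
  imports "HOL-Analysis.Analysis"
begin

end

theory Submission
  imports Defs
begin

text \<open>
  Let G be the inverse of F and call f unimodular if |f| = 1 everywhere. Then F 0 = 0, and G maps
  unimodular functions to unimodular functions. If f = G e with e unimodular, then f u \<open>\<ge>\<close> s implies
  e F(u) \<open>\<ge>\<close> s; so F maps the cone of functions whose sign is compatible with several unimodular G e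
  injectively into the cone of functions compatible with the corresponding e. Comparing cones of dimension
  0, 1 and 2 shows that G (- e) = - G e, that changing the sign of e at one isolated point n changes
  the sign of G e at exactly one isolated point y(n), and that y is onto the isolated points. Since there are
  finitely many sign patterns on the accumulation points, G is onto the unimodular functions, so that
  F f (n) = \<open>\<epsilon>\<close>(n) f (y(n)) for unimodular f.

  It follows that |F u (n)| \<open>\<le>\<close> |u (y(n))|, and hence that F maps each sub-ball of functions u with
  f u \<open>\<ge>\<close> a > 0 onto the sub-ball of functions v with F(f) v \<open>\<ge>\<close> a. Rescaled to the unit
  ball, this restriction is again a non-expansive bijection, with the same y and \<open>\<epsilon>\<close>. The error
  |F u (n) - \<open>\<epsilon>\<close>(n) u (y(n))| is thus halved by passing to sub-balls, so it vanishes and F is an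
  isometry.
\<close>

section \<open>Compact spaces with finitely many accumulation points\<close>

text \<open>These are exactly the extreme points of the closed unit ball.\<close>

definition unimodular :: "('a::topological_space \<Rightarrow>\<^sub>C real) set" where
  "unimodular = {f :: 'a \<Rightarrow>\<^sub>C real. \<forall>x. \<bar>f x\<bar> = 1}"

text \<open>Used at isolated \<open>x\<close> only: elsewhere the indicator is not continuous and
  \<open>Bcontfun\<close> returns an unspecified function.\<close>

definition point_mass :: "'a::topological_space \<Rightarrow> ('a \<Rightarrow>\<^sub>C real)" where
  "point_mass x = Bcontfun (indicator {x})"

definition flip :: "'a::topological_space \<Rightarrow> ('a \<Rightarrow>\<^sub>C real) \<Rightarrow> ('a \<Rightarrow>\<^sub>C real)" where
  "flip x f = f - (2 * f x) *\<^sub>R point_mass x"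

lemma unimodularD: "f \<in> unimodular \<Longrightarrow> f x = 1 \<or> f x = -1"
  by (simp add: unimodular_def) (metis abs_1 abs_eq_iff)

lemma norm_bcontfun_le_iff:
  fixes f :: "'a::topological_space \<Rightarrow>\<^sub>C real"
  shows "norm f \<le> b \<longleftrightarrow> (\<forall>x. \<bar>f x\<bar> \<le> b)"
  by (metis norm_bound norm_bounded order_trans real_norm_def)

lemma dist_bcontfun_le_iff:
  fixes f g :: "'a::topological_space \<Rightarrow>\<^sub>C real"
  shows "dist f g \<le> b \<longleftrightarrow> (\<forall>x. \<bar>f x - g x\<bar> \<le> b)"
  by (metis dist_bound dist_bounded dist_real_def order_trans)

lemma unimodular_in_cball: "f \<in> unimodular \<Longrightarrow> f \<in> cball 0 1"
  by (auto simp: norm_bcontfun_le_iff unimodular_def)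

lemma unimodular_uminus: "f \<in> unimodular \<Longrightarrow> - f \<in> unimodular"
  by (auto simp: unimodular_def)

lemma one_unimodular: "const_bcontfun 1 \<in> unimodular"
  by (auto simp: unimodular_def)

locale compact_finite_acc =
  fixes K :: "'a::topological_space itself"
  assumes compact_UNIV: "compact (UNIV :: 'a set)"
    and closed_singleton: "\<And>x::'a. closed {x}"
    and finite_acc: "finite {x::'a. \<not> open {x}}"
begin

text \<open>Isolated points are dense: an open set without them lies in the finite set of
  accumulation points, and removing all its points but \<open>x\<close> would leave {x}
  open.\<close>

lemma open_contains_isolated:
  fixes U :: "'a set"
  assumes "open U" "x \<in> U"
  obtains z where "z \<in> U" "open {z}"
proof -
  have "\<exists>z\<in>U. open {z}"
  proof (rule ccontr)
    assume no: "\<not> ?thesis"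
    then have "finite U"
      by (intro finite_subset[OF _ finite_acc]) auto
    then have "closed (\<Union>z\<in>U - {x}. {z})"
      using closed_singleton by (intro closed_UN) auto
    then have "open (U - (U - {x}))"
      using \<open>open U\<close> by (intro open_Diff) auto
    moreover have "U - (U - {x}) = {x}"
      using \<open>x \<in> U\<close> by auto
    ultimately show False
      using no \<open>x \<in> U\<close> by auto
  qed
  then show thesis using that by blast
qed

lemma closed_isolated_finite:
  fixes S :: "'a set"
  assumes "closed S" "\<And>x. x \<in> S \<Longrightarrow> open {x}"
  shows "finite S"
proof -
  have "compact S"
    using compact_Int_closed[OF compact_UNIV \<open>closed S\<close>] by simp
  moreover have "S \<subseteq> \<Union> ((\<lambda>x. {x}) ` S)" "\<And>B. B \<in> (\<lambda>x. {x}) ` S \<Longrightarrow> open B"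
    using assms(2) by auto
  ultimately obtain C where C: "C \<subseteq> (\<lambda>x. {x}) ` S" "finite C" "S \<subseteq> \<Union>C"
    by (rule compactE)
  moreover have "finite (\<Union>C)"
    using C by (intro finite_Union) auto
  ultimately show ?thesis by (auto intro: finite_subset)
qed

lemma apply_Bcontfun:
  fixes f :: "'a \<Rightarrow> real"
  assumes "continuous_on UNIV f"
  shows "apply_bcontfun (Bcontfun f) = f"
proof -
  have "bounded (range f)"
    using compact_continuous_image[OF assms compact_UNIV] by (rule compact_imp_bounded)
  then show ?thesis
    using assms by (simp add: Bcontfun_inverse bcontfun_def)
qed

lemma continuous_on_clopen_indicator:
  fixes P :: "'a set"
  assumes "open P" "closed P"
  shows "continuous_on UNIV (indicator P :: 'a \<Rightarrow> real)"
proof -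
  have "continuous_on P (indicator P :: 'a \<Rightarrow> real)"
    by (rule continuous_on_eq[of _ "\<lambda>_. 1"]) auto
  moreover have "continuous_on (- P) (indicator P :: 'a \<Rightarrow> real)"
    by (rule continuous_on_eq[of _ "\<lambda>_. 0"]) auto
  ultimately have "continuous_on (P \<union> - P) (indicator P :: 'a \<Rightarrow> real)"
    using assms by (intro continuous_on_open_Un) auto
  then show ?thesis by simp
qed

lemma point_mass_apply:
  fixes x :: 'a
  assumes "open {x}"
  shows "point_mass x z = (if z = x then 1 else 0)"
  using apply_Bcontfun[OF continuous_on_clopen_indicator[OF assms closed_singleton]]
  by (simp add: point_mass_def indicator_def)

lemma flip_apply:
  fixes x :: 'a
  assumes "open {x}"
  shows "flip x f z = (if z = x then - f x else f z)"
  by (simp add: flip_def point_mass_apply[OF assms])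

lemma flip_unimodular: "open {x::'a} \<Longrightarrow> f \<in> unimodular \<Longrightarrow> flip x f \<in> unimodular"
  by (auto simp: unimodular_def flip_apply)

lemma le_if_le_on_isolated:
  fixes h k :: "'a \<Rightarrow> real"
  assumes "continuous_on UNIV h" "continuous_on UNIV k"
    and "\<And>x. open {x} \<Longrightarrow> h x \<le> k x"
  shows "h x \<le> k x"
proof (rule ccontr)
  assume "\<not> h x \<le> k x"
  moreover have "open {x. k x < h x}"
    using assms by (intro open_Collect_less) auto
  ultimately obtain z where "k z < h z" "open {z}"
    by (metis (mono_tags, lifting) mem_Collect_eq not_le open_contains_isolated)
  then show False using assms(3)[of z] by simp
qed

lemma eq_if_eq_on_isolated:
  fixes f g :: "'a \<Rightarrow>\<^sub>C real"
  assumes "\<And>x. open {x} \<Longrightarrow> f x = g x"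
  shows "f = g"
proof (rule bcontfun_eqI)
  fix x
  have "f x \<le> g x" "g x \<le> f x"
    by (rule le_if_le_on_isolated; simp add: assms)+
  then show "f x = g x" by simp
qed

text \<open>Choose \<open>c\<close> outside the finitely many values of \<open>u\<close> at
  accumulation points. The level set of \<open>c\<close> is then open, so the points with value
  above \<open>c\<close> form a clopen set and \<open>s\<close> is continuous.\<close>

lemma threshold_sign:
  fixes u :: "'a \<Rightarrow>\<^sub>C real"
  assumes "0 < \<delta>"
  obtains c s where "0 < c" "c < \<delta>" "s \<in> unimodular" "\<And>x. s x = (if c < u x then 1 else -1)"
proof -
  have "infinite ({0<..<\<delta>} - u ` {x. \<not> open {x}})"
    using assms finite_acc by (simp add: Diff_infinite_finite infinite_Ioo)
  then obtain c where "c \<in> {0<..<\<delta>} - u ` {x. \<not> open {x}}"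
    by (metis (no_types, lifting) ex_in_conv infinite_imp_nonempty)
  then have c: "0 < c" "c < \<delta>" "\<And>x. u x = c \<Longrightarrow> open {x}"
    by auto
  define P where "P = {x. c < u x}"
  have "open P" unfolding P_def by (intro open_Collect_less) auto
  have "open (\<Union>x\<in>{x. u x = c}. {x})"
    using c(3) by blast
  then have "open {x. u x = c}" by simp
  have "closed ({x. c \<le> u x} - {x. u x = c})"
    by (intro closed_Diff closed_Collect_le \<open>open {x. u x = c}\<close>) auto
  moreover have "{x. c \<le> u x} - {x. u x = c} = P" by (auto simp: P_def)
  ultimately have "closed P" by simp
  define s where "s = Bcontfun (\<lambda>x. 2 * indicator P x - 1 :: real)"
  have s: "s x = (if c < u x then 1 else -1)" for x
    unfolding s_def using \<open>open P\<close> \<open>closed P\<close>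
    by (subst apply_Bcontfun)
       (auto intro!: continuous_intros continuous_on_clopen_indicator simp: P_def)
  then have "s \<in> unimodular" by (simp add: unimodular_def)
  with s c show thesis using that by blast
qed

text \<open>Functions bounded away from zero are dense in the ball: values not exceeding
  \<open>c\<close> are lowered to at most \<open>- c\<close>, a change of at most
  \<open>2 * c\<close>.\<close>

lemma nonvanishing_approx:
  fixes u :: "'a \<Rightarrow>\<^sub>C real"
  assumes "u \<in> cball 0 1" "0 < \<delta>"
  obtains a s w where "0 < a" "a < 1" "s \<in> unimodular" "w \<in> cball 0 1" "dist w u \<le> \<delta>"
    "\<And>x. a \<le> s x * w x"
proof -
  obtain c s where c: "0 < c" "c < min 1 (\<delta> / 2)" and s: "s \<in> unimodular"
      "\<And>x. s x = (if c < u x then 1 else -1)"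
    using threshold_sign[of "min 1 (\<delta> / 2)" u] assms(2) by auto
  \<comment> \<open>Writing the case distinction through the continuous sign \<open>s\<close> makes
    continuity of \<open>w\<close> visible.\<close>
  define w where "w = Bcontfun (\<lambda>x. (1 + s x) / 2 * u x + (1 - s x) / 2 * min (u x) (- c))"
  have cont: "continuous_on UNIV (\<lambda>x. (1 + s x) / 2 * u x + (1 - s x) / 2 * min (u x) (- c))"
    by (intro continuous_intros) auto
  have w: "w x = (if c < u x then u x else min (u x) (- c))" for x
    unfolding w_def apply_Bcontfun[OF cont] by (simp add: s)
  have c': "c < 1" "2 * c < \<delta>" using c by auto
  have u: "\<bar>u x\<bar> \<le> 1" for x using assms(1) by (simp add: norm_bcontfun_le_iff)
  have "\<bar>w x\<bar> \<le> 1" for x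
    using u[of x] c(1) c' by (auto simp: w min_def)
  moreover have "\<bar>w x - u x\<bar> \<le> \<delta>" for x
    using c(1) c' by (auto simp: w min_def)
  moreover have "c \<le> s x * w x" for x
    using c(1) c' by (auto simp: w s min_def)
  ultimately show thesis
    using that[of c s w] c(1) c' s(1) by (auto simp: norm_bcontfun_le_iff dist_bcontfun_le_iff)
qed

end

section \<open>The action on extreme points\<close>

text \<open>A locale, because its results are applied to rescaled restrictions of \<open>F\<close>
  as well.\<close>

locale nonexpansive_ball_bijection = compact_finite_acc "TYPE('a)"
  for F :: "('a::topological_space \<Rightarrow>\<^sub>C real) \<Rightarrow> ('a \<Rightarrow>\<^sub>C real)" +
  assumes bij: "bij_betw F (cball 0 1) (cball 0 1)"
    and nonexp: "\<And>f g. f \<in> cball 0 1 \<Longrightarrow> g \<in> cball 0 1 \<Longrightarrow> dist (F f) (F g) \<le> dist f g"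
begin

definition G :: "('a \<Rightarrow>\<^sub>C real) \<Rightarrow> ('a \<Rightarrow>\<^sub>C real)" where
  "G = inv_into (cball 0 1) F"

lemma F_cball: "f \<in> cball 0 1 \<Longrightarrow> F f \<in> cball 0 1"
  using bij by (rule bij_betw_apply)

lemma F_inj: "f \<in> cball 0 1 \<Longrightarrow> g \<in> cball 0 1 \<Longrightarrow> F f = F g \<Longrightarrow> f = g"
  using bij by (meson bij_betw_imp_inj_on inj_onD)

lemma G_cball: "f \<in> cball 0 1 \<Longrightarrow> G f \<in> cball 0 1"
  unfolding G_def using bij by (metis bij_betw_def inv_into_into)

lemma F_G: "f \<in> cball 0 1 \<Longrightarrow> F (G f) = f"
  unfolding G_def using bij by (rule bij_betw_inv_into_right)

lemma G_F: "f \<in> cball 0 1 \<Longrightarrow> G (F f) = f"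
  unfolding G_def using bij by (rule bij_betw_inv_into_left)

lemma F_pointwise_nonexp:
  fixes f g :: "'a \<Rightarrow>\<^sub>C real"
  assumes "f \<in> cball 0 1" "g \<in> cball 0 1" "\<And>x. \<bar>f x - g x\<bar> \<le> b"
  shows "\<bar>F f z - F g z\<bar> \<le> b"
  using nonexp[OF assms(1,2)] assms(3) by (meson dist_bcontfun_le_iff order_trans)

text \<open>The unit vector \<open>v\<close> opposite to a nonzero \<open>F 0\<close> has distance
  \<open>1 + norm (F 0)\<close> from it, but its preimage has distance at most 1 from 0.\<close>

lemma F_zero: "F 0 = 0"
proof (rule ccontr)
  assume nz: "F 0 \<noteq> 0"
  define v where "v = (- 1 / norm (F 0)) *\<^sub>R F 0"
  have v: "v \<in> cball 0 1" using nz by (simp add: v_def)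
  have "dist v (F 0) = norm ((- 1 / norm (F 0) - 1) *\<^sub>R F 0)"
    by (simp add: dist_norm v_def algebra_simps)
  also have "\<dots> = 1 + norm (F 0)"
  proof -
    have "0 \<le> 1 / norm (F 0)" by simp
    then have "- 1 / norm (F 0) - 1 \<le> 0" by linarith
    then show ?thesis using nz by (simp add: field_simps)
  qed
  finally have "dist v (F 0) > 1" using nz by simp
  moreover have "dist v (F 0) \<le> dist (G v) 0"
    using nonexp[OF G_cball[OF v], of 0] F_G[OF v] by simp
  ultimately show False using G_cball[OF v] by simp
qed

text \<open>For unimodular e, the only point at distance at most 1/2 from both 0 and e is e/2; by injectivity
  of F the same is true of G e, which forces G e to be unimodular.\<close>
lemma G_unimodular:
  assumes "e \<in> unimodular"
  shows "G e \<in> unimodular"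
proof (rule ccontr)
  define f where "f = G e"
  have e: "e \<in> cball 0 1" by (rule unimodular_in_cball[OF assms])
  have f: "f \<in> cball 0 1" "F f = e" using e by (auto simp: f_def G_cball[simplified] F_G)
  have f1: "\<bar>f x\<bar> \<le> 1" for x using f(1) by (simp add: norm_bcontfun_le_iff)
  assume "G e \<notin> unimodular"
  then obtain x where "\<bar>f x\<bar> < 1"
    using f1 by (auto simp: unimodular_def f_def order_less_le)
  moreover have "open {x. \<bar>f x\<bar> < 1}"
    by (intro open_Collect_less continuous_intros) auto
  ultimately obtain z where z: "\<bar>f z\<bar> < 1" "open {z}"
    using open_contains_isolated[of "{x. \<bar>f x\<bar> < 1}" x] by auto
  \<comment> \<open>The height of the bump is chosen so that \<open>u\<close> and
    \<open>u - f\<close> stay within 1/2 at \<open>z\<close>, where \<open>u\<close> differs from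
    \<open>f\<close> / 2.\<close>
  define u where "u = (1 / 2) *\<^sub>R f + ((1 - \<bar>f z\<bar>) / 2) *\<^sub>R point_mass z"
  have half: "F w = (1 / 2) *\<^sub>R e" if w: "\<And>x. \<bar>w x\<bar> \<le> 1 / 2" "\<And>x. \<bar>w x - f x\<bar> \<le> 1 / 2" for w :: "'a \<Rightarrow>\<^sub>C real"
  proof (rule bcontfun_eqI)
    fix x
    have "\<bar>w x\<bar> \<le> 1" for x using w(1)[of x] by linarith
    then have wB: "w \<in> cball 0 1" by (simp add: norm_bcontfun_le_iff)
    have "\<bar>F w x - F 0 x\<bar> \<le> 1 / 2"
      by (rule F_pointwise_nonexp[OF wB]) (use w(1) in simp_all)
    moreover have "\<bar>F w x - F f x\<bar> \<le> 1 / 2"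
      by (rule F_pointwise_nonexp[OF wB f(1) w(2)])
    ultimately show "F w x = ((1 / 2) *\<^sub>R e) x"
      using unimodularD[OF assms, of x] by (auto simp: F_zero f(2))
  qed
  have u1: "\<bar>u x\<bar> \<le> 1 / 2" for x
    using f1[of x] by (auto simp: u_def point_mass_apply[OF z(2)] abs_if field_simps split: if_splits)
  have "\<bar>u x - f x\<bar> \<le> 1 / 2" for x
    using f1[of x] by (auto simp: u_def point_mass_apply[OF z(2)] abs_if field_simps split: if_splits)
  then have "F u = (1 / 2) *\<^sub>R e"
    by (rule half[OF u1])
  moreover have "F ((1 / 2) *\<^sub>R f) = (1 / 2) *\<^sub>R e"
  proof (rule half)
    fix x
    show "\<bar>((1 / 2) *\<^sub>R f) x\<bar> \<le> 1 / 2" "\<bar>((1 / 2) *\<^sub>R f) x - f x\<bar> \<le> 1 / 2"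
      using f1[of x] by (auto simp: abs_if field_simps split: if_splits)
  qed
  moreover have "\<bar>u x\<bar> \<le> 1" for x using u1[of x] by linarith
  then have "u \<in> cball 0 1" by (simp add: norm_bcontfun_le_iff)
  moreover have "(1 / 2) *\<^sub>R f \<in> cball 0 1"
    using f(1) by simp
  ultimately have "u = (1 / 2) *\<^sub>R f"
    using F_inj by metis
  then have "u z = ((1 / 2) *\<^sub>R f) z" by simp
  then show False using z by (simp add: u_def point_mass_apply[OF z(2)])
qed

lemma G_unimodular_cball: "e \<in> unimodular \<Longrightarrow> G e \<in> cball 0 1"
  by (intro unimodular_in_cball G_unimodular)

text \<open>For a sign e and a value t in [-1, 1], the distance of t from e is 1 - e t. The
  hypothesis is thus a bound on the distance of \<open>u\<close> from \<open>G e\<close>, which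
  \<open>F\<close> carries over to \<open>F u\<close> and \<open>e\<close>.\<close>

lemma F_lower_bound:
  fixes e u :: "'a \<Rightarrow>\<^sub>C real"
  assumes "e \<in> unimodular" "u \<in> cball 0 1" "\<And>x. s \<le> G e x * u x"
  shows "s \<le> e z * F u z"
proof -
  have "\<bar>u x - G e x\<bar> \<le> 1 - s" for x
  proof -
    have "\<bar>u x\<bar> \<le> 1" using assms(2) by (simp add: norm_bcontfun_le_iff)
    then show ?thesis
      using assms(3)[of x] unimodularD[OF G_unimodular[OF assms(1)], of x] by auto
  qed
  then have "\<bar>F u z - F (G e) z\<bar> \<le> 1 - s"
    by (intro F_pointwise_nonexp assms(2) G_unimodular_cball[OF assms(1)])
  then have "\<bar>F u z - e z\<bar> \<le> 1 - s"
    using F_G[OF unimodular_in_cball[OF assms(1)]] by simp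
  then show ?thesis
    using unimodularD[OF assms(1), of z] by auto
qed

text \<open>The function \<open>b *\<^sub>R point_mass x\<close> is compatible in sign with every
  \<open>G e\<close>. Its image is nonzero by injectivity, hence nonzero at some isolated
  \<open>n\<close>, where its sign dictates the value of every \<open>e\<close>.\<close>

lemma common_value:
  fixes S :: "('a \<Rightarrow>\<^sub>C real) set"
  assumes S: "S \<subseteq> unimodular" and x: "open {x}" and b: "\<bar>b\<bar> = 1" "\<And>e. e \<in> S \<Longrightarrow> G e x = b"
  obtains n t where "open {n}" "\<And>e :: 'a \<Rightarrow>\<^sub>C real. e \<in> S \<Longrightarrow> e n = t"
proof -
  define u where "u = b *\<^sub>R point_mass x"
  have u: "u \<in> cball 0 1"
    using b(1) by (auto simp: u_def norm_bcontfun_le_iff point_mass_apply[OF x])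
  have "u x \<noteq> 0" using b(1) by (auto simp: u_def point_mass_apply[OF x])
  then have "u \<noteq> 0" by auto
  then have "F u \<noteq> 0"
    using F_inj[OF u, of 0] F_zero by auto
  then obtain n where n: "open {n}" "F u n \<noteq> 0"
    using eq_if_eq_on_isolated[of "F u" 0] by auto
  have "e n = sgn (F u n)" if "e \<in> S" for e :: "'a \<Rightarrow>\<^sub>C real"
  proof -
    have e: "e \<in> unimodular" using S that by blast
    have "0 \<le> e n * F u n"
      using b that by (intro F_lower_bound[OF e u]) (auto simp: u_def point_mass_apply[OF x])
    then show ?thesis
      using n(2) unimodularD[OF e, of n] by (auto simp: sgn_if)
  qed
  then show thesis using that n(1) by blast
qed

text \<open>Since \<open>e\<close> and \<open>- e\<close> agree nowhere, \<open>common_value\<close>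
  forbids their preimages to agree at an isolated point.\<close>

lemma G_uminus:
  assumes e: "e \<in> unimodular"
  shows "G (- e) = - G e"
proof (rule eq_if_eq_on_isolated, rule ccontr)
  fix x :: 'a
  have e': "- e \<in> unimodular" by (rule unimodular_uminus[OF e])
  assume x: "open {x}" and "G (- e) x \<noteq> (- G e) x"
  then have "G (- e) x = G e x"
    using unimodularD[OF G_unimodular[OF e], of x] unimodularD[OF G_unimodular[OF e'], of x] by auto
  moreover have "\<bar>G e x\<bar> = 1"
    using G_unimodular[OF e] by (simp add: unimodular_def)
  ultimately obtain n t where nt: "\<And>d :: 'a \<Rightarrow>\<^sub>C real. d \<in> {e, - e} \<Longrightarrow> d n = t"
    using e e' common_value[of "{e, - e}" x "G e x", OF _ x] by blast
  show False using nt[of e] nt[of "- e"] unimodularD[OF e, of n] by auto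
qed

lemma continuous_on_F_apply: "continuous_on (cball 0 1) (\<lambda>u. F u n)"
proof (rule continuous_onI)
  fix u :: "'a \<Rightarrow>\<^sub>C real" and \<epsilon> :: real
  assume u: "u \<in> cball 0 1" and "0 < \<epsilon>"
  have "dist (F v n) (F u n) \<le> \<epsilon>" if "v \<in> cball 0 1" "dist v u < \<epsilon>" for v
    using dist_bounded[of "F v" n "F u"] nonexp[OF that(1) u] that(2) by linarith
  then show "\<exists>d>0. \<forall>v\<in>cball 0 1. dist v u < d \<longrightarrow> dist (F v n) (F u n) \<le> \<epsilon>"
    using \<open>0 < \<epsilon>\<close> by blast
qed

text \<open>The points of disagreement of G e and G (flip n e) are the points of agreement of G e and
  G (- flip n e). If there were two of them, F would map a square injectively and continuously into the
  line of functions supported at n.\<close>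
lemma G_flip_ex:
  assumes e: "e \<in> unimodular" and n: "open {n}"
  obtains x where "open {x}" "G (flip n e) = flip x (G e)"
proof -
  define f f' where "f = G e" and "f' = G (flip n e)"
  have e': "flip n e \<in> unimodular" by (rule flip_unimodular[OF n e])
  have f: "f z = 1 \<or> f z = -1" and f': "f' z = 1 \<or> f' z = -1" for z
    using unimodularD[OF G_unimodular[OF e]] unimodularD[OF G_unimodular[OF e']]
    by (auto simp: f_def f'_def)
  define D where "D = {x. f x * f' x < 0}"
  have D: "x \<in> D \<longleftrightarrow> f' x = - f x" for x
    using f[of x] f'[of x] by (auto simp: D_def)
  have openD: "open D"
    unfolding D_def by (intro open_Collect_less continuous_intros) auto
  have "flip n e n \<noteq> e n"
    using unimodularD[OF e, of n] by (auto simp: flip_apply[OF n])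
  then have "f \<noteq> f'"
    unfolding f_def f'_def
    by (metis F_G e e' unimodular_in_cball)
  then obtain x where x: "open {x}" "f x \<noteq> f' x"
    using eq_if_eq_on_isolated[of f f'] by auto
  then have "x \<in> D" using f[of x] f'[of x] by (auto simp: D)
  have unique: "z = x" if z: "open {z}" "z \<in> D" for z
  proof (rule ccontr)
    assume "z \<noteq> x"
    define U where "U s t = (s * f x) *\<^sub>R point_mass x + (t * f z) *\<^sub>R point_mass z" for s t :: real
    have U: "U s t k = (if k = x then s * f x else if k = z then t * f z else 0)" for s t k
      using \<open>z \<noteq> x\<close> by (simp add: U_def point_mass_apply x(1) z(1))
    have UB: "U s t \<in> cball 0 1" if "s \<in> {0..1}" "t \<in> {0..1}" for s t
      using that f[of x] f[of z] by (auto simp: norm_bcontfun_le_iff U)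
    \<comment> \<open>\<open>e\<close> and \<open>- flip n e\<close> have opposite signs away from
      \<open>n\<close>, so compatibility with both forces the value 0 there.\<close>
    have FU: "F (U s t) k = 0" if "s \<in> {0..1}" "t \<in> {0..1}" "k \<noteq> n" for s t k
    proof -
      have "0 \<le> e k * F (U s t) k"
        using that f[of x] f[of z]
        by (intro F_lower_bound[OF e UB]) (auto simp: U f_def)
      moreover have "0 \<le> (- flip n e) k * F (U s t) k"
      proof (intro F_lower_bound[OF unimodular_uminus[OF e'] UB] that)
        fix j show "0 \<le> G (- flip n e) j * U s t j"
          using that f[of x] f[of z] z(2) \<open>x \<in> D\<close>
          by (auto simp: U G_uminus[OF e'] D f'_def[symmetric])
      qed
      ultimately show ?thesis
        using that(3) unimodularD[OF e, of k] by (auto simp: flip_apply[OF n])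
    qed
    have inj: "s = s' \<and> t = t'" if "s \<in> {0..1}" "t \<in> {0..1}" "s' \<in> {0..1}" "t' \<in> {0..1}"
      "F (U s t) n = F (U s' t') n" for s t s' t'
    proof -
      have "F (U s t) = F (U s' t')"
        by (rule bcontfun_eqI) (metis FU that)
      then have "U s t = U s' t'"
        by (rule F_inj[OF UB[OF that(1,2)] UB[OF that(3,4)]])
      then have "U s t x = U s' t' x" "U s t z = U s' t' z" by auto
      then show ?thesis
        using f[of x] f[of z] \<open>z \<noteq> x\<close> by (auto simp: U)
    qed
    \<comment> \<open>Two paths swapping the corners (0,0) and (1,1) that never meet at the same time.\<close>
    define h where "h \<tau> = F (U \<tau> (\<tau>\<^sup>2)) n - F (U (1 - \<tau>) (1 - \<tau>\<^sup>2)) n" for \<tau> :: real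
    have sq: "\<tau>\<^sup>2 \<in> {0..1}" if "\<tau> \<in> {0..1}" for \<tau> :: real
      using that by (auto simp: power_le_one)
    have "continuous_on {0..1} (\<lambda>\<tau>. F (U \<tau> (\<tau>\<^sup>2)) n)"
    proof (rule continuous_on_compose2[OF continuous_on_F_apply])
      show "continuous_on {0..1} (\<lambda>\<tau>. U \<tau> (\<tau>\<^sup>2))"
        unfolding U_def by (intro continuous_intros)
      show "(\<lambda>\<tau>. U \<tau> (\<tau>\<^sup>2)) ` {0..1} \<subseteq> cball 0 1"
        using UB sq by blast
    qed
    moreover have "continuous_on {0..1} (\<lambda>\<tau>. F (U (1 - \<tau>) (1 - \<tau>\<^sup>2)) n)"
    proof (rule continuous_on_compose2[OF continuous_on_F_apply])
      show "continuous_on {0..1} (\<lambda>\<tau>. U (1 - \<tau>) (1 - \<tau>\<^sup>2))"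
        unfolding U_def by (intro continuous_intros)
      show "(\<lambda>\<tau>. U (1 - \<tau>) (1 - \<tau>\<^sup>2)) ` {0..1} \<subseteq> cball 0 1"
      proof (rule image_subsetI)
        fix \<tau> :: real assume "\<tau> \<in> {0..1}"
        then show "U (1 - \<tau>) (1 - \<tau>\<^sup>2) \<in> cball 0 1"
          using sq[of \<tau>] by (intro UB) auto
      qed
    qed
    ultimately have cont: "continuous_on {0..1} h"
      unfolding h_def by (intro continuous_intros)
    have "h 1 = - h 0" by (simp add: h_def)
    then have "\<exists>\<tau>. 0 \<le> \<tau> \<and> \<tau> \<le> 1 \<and> h \<tau> = 0"
      using IVT'[of h 0 0 1] IVT2'[of h 1 0 0] cont by (cases "h 0 \<le> 0") auto
    then obtain \<tau> where \<tau>: "\<tau> \<in> {0..1}" "h \<tau> = 0" by auto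
    then have "\<tau> = 1 - \<tau> \<and> \<tau>\<^sup>2 = 1 - \<tau>\<^sup>2"
      using sq[of \<tau>] by (intro inj) (auto simp: h_def)
    then have \<tau>: "\<tau> = 1 / 2" "\<tau>\<^sup>2 = 1 / 2" by auto
    show False using \<tau>(2) unfolding \<tau>(1) by (simp add: power2_eq_square)
  qed
  \<comment> \<open>Since \<open>D\<close> is open, a further point of any kind would yield a
    further isolated one.\<close>
  have "D \<subseteq> {x}"
  proof (rule ccontr)
    assume "\<not> D \<subseteq> {x}"
    then obtain z where "z \<in> D - {x}" by auto
    moreover have "open (D - {x})" using openD closed_singleton by (intro open_Diff) auto
    ultimately obtain z' where "z' \<in> D - {x}" "open {z'}"
      using open_contains_isolated by metis
    then show False using unique by auto
  qed
  have "f' = flip x f"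
  proof (rule bcontfun_eqI)
    fix z
    show "f' z = flip x f z"
      using D[of x] D[of z] \<open>D \<subseteq> {x}\<close> \<open>x \<in> D\<close> f[of z] f'[of z] by (auto simp: flip_apply[OF x(1)])
  qed
  then show thesis
    using that[OF x(1)] by (simp add: f_def f'_def)
qed

text \<open>The point is chosen for the constant 1 only; \<open>G_flip\<close> shows that it serves
  every unimodular function.\<close>

definition y :: "'a \<Rightarrow> 'a" where
  "y n = (SOME x. open {x} \<and> G (flip n (const_bcontfun 1)) = flip x (G (const_bcontfun 1)))"

lemma y: "open {n} \<Longrightarrow> open {y n}"
  and G_flip_one: "open {n} \<Longrightarrow> G (flip n (const_bcontfun 1)) = flip (y n) (G (const_bcontfun 1))"
proof -
  assume "open {n}"
  then have "\<exists>x. open {x} \<and> G (flip n (const_bcontfun 1)) = flip x (G (const_bcontfun 1))"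
    using G_flip_ex[OF one_unimodular] by metis
  then have "open {y n} \<and> G (flip n (const_bcontfun 1)) = flip (y n) (G (const_bcontfun 1))"
    unfolding y_def by (rule someI_ex)
  then show "open {y n}" "G (flip n (const_bcontfun 1)) = flip (y n) (G (const_bcontfun 1))"
    by auto
qed

text \<open>The functions 1 and - flip n 1 agree only at n, so adding e to them leaves no point of agreement
  unless e n = 1.\<close>
lemma G_apply_y:
  assumes e: "e \<in> unimodular" and n: "open {n}"
  shows "G e (y n) = e n * G (const_bcontfun 1) (y n)"
proof -
  define b where "b = G (const_bcontfun 1) (y n)"
  have b: "\<bar>b\<bar> = 1"
    using G_unimodular[OF one_unimodular] by (simp add: b_def unimodular_def)
  define m :: "'a \<Rightarrow>\<^sub>C real" where "m = flip n (const_bcontfun 1)"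
  have m: "m \<in> unimodular"
    unfolding m_def by (rule flip_unimodular[OF n one_unimodular])
  have Gm: "G (- m) (y n) = b"
    using G_flip_one[OF n] by (simp add: G_uminus[OF m] b_def flip_apply[OF y[OF n]] flip: m_def)
  have one: "d n = 1" if d: "d \<in> unimodular" "G d (y n) = b" for d :: "'a \<Rightarrow>\<^sub>C real"
  proof -
    have "{const_bcontfun 1, - m, d} \<subseteq> unimodular"
      using d m one_unimodular unimodular_uminus by auto
    moreover have "G k (y n) = b" if "k \<in> {const_bcontfun 1, - m, d}" for k
      using that Gm d(2) by (auto simp: b_def)
    ultimately obtain k t where
      k: "\<And>j :: 'a \<Rightarrow>\<^sub>C real. j \<in> {const_bcontfun 1, - m, d} \<Longrightarrow> j k = t"
      using common_value[OF _ y[OF n] b] by metis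
    have "k = n"
      using k[of "const_bcontfun 1"] k[of "- m"] by (auto simp: m_def flip_apply[OF n] split: if_splits)
    then show ?thesis
      using k[of "const_bcontfun 1"] k[of d] by simp
  qed
  have "G e (y n) = b \<or> G (- e) (y n) = b"
    using unimodularD[OF G_unimodular[OF e], of "y n"] b by (auto simp: G_uminus[OF e])
  then show ?thesis
  proof
    assume "G e (y n) = b"
    then show ?thesis using one[OF e] by (simp add: b_def)
  next
    assume *: "G (- e) (y n) = b"
    then have "e n = -1" using one[OF unimodular_uminus[OF e]] by simp
    then show ?thesis using * by (simp add: G_uminus[OF e] b_def)
  qed
qed

text \<open>By \<open>G_apply_y\<close> the value at \<open>y n\<close> changes sign, so the single
  flipped point must be \<open>y n\<close>.\<close>

lemma G_flip:
  assumes e: "e \<in> unimodular" and n: "open {n}"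
  shows "G (flip n e) = flip (y n) (G e)"
proof -
  obtain x where x: "open {x}" "G (flip n e) = flip x (G e)"
    using G_flip_ex[OF e n] .
  have "flip x (G e) (y n) = - G e (y n)"
    using G_apply_y[OF flip_unimodular[OF n e] n] G_apply_y[OF e n]
    by (simp add: x(2)[symmetric] flip_apply[OF n])
  then have "y n = x"
    using unimodularD[OF G_unimodular[OF e], of "y n"]
    by (auto simp: flip_apply[OF x(1)] split: if_splits)
  then show ?thesis using x by simp
qed

text \<open>If \<open>x\<close> were missed, the preimages of 1 and of all its flips would agree at
  \<open>x\<close>. By \<open>common_value\<close> these functions would share a value at some
  isolated \<open>n\<close>, but flipping 1 at \<open>n\<close> changes it there.\<close>

lemma y_surj:
  assumes x: "open {x}"
  shows "\<exists>n. open {n} \<and> y n = x"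
proof (rule ccontr)
  assume no: "\<not> ?thesis"
  define S :: "('a \<Rightarrow>\<^sub>C real) set" where
    "S = insert (const_bcontfun 1) ((\<lambda>n. flip n (const_bcontfun 1)) ` {n. open {n}})"
  define b where "b = G (const_bcontfun 1) x"
  have b: "\<bar>b\<bar> = 1"
    using G_unimodular[OF one_unimodular] by (simp add: b_def unimodular_def)
  have "S \<subseteq> unimodular"
    using one_unimodular flip_unimodular by (auto simp: S_def)
  moreover have "G e x = b" if "e \<in> S" for e
  proof -
    have "G (flip n (const_bcontfun 1)) x = b" if n: "open {n}" for n
      using no n by (auto simp: G_flip_one[OF n] flip_apply[OF y[OF n]] b_def)
    then show ?thesis using that by (auto simp: S_def b_def)
  qed
  ultimately obtain n t where n: "open {n}" and nt: "\<And>e :: 'a \<Rightarrow>\<^sub>C real. e \<in> S \<Longrightarrow> e n = t"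
    using common_value[OF _ x b] by metis
  show False
    using nt[of "const_bcontfun 1"] nt[of "flip n (const_bcontfun 1)"] n
    by (auto simp: S_def flip_apply[OF n])
qed

section \<open>Sign patterns on the accumulation points\<close>

definition acc_eq :: "('a \<Rightarrow>\<^sub>C real) \<Rightarrow> ('a \<Rightarrow>\<^sub>C real) \<Rightarrow> bool" where
  "acc_eq f g \<longleftrightarrow> (\<forall>x. \<not> open {x} \<longrightarrow> f x = g x)"

text \<open>\<open>f\<close> and \<open>G e\<close> differ on a closed set of isolated points, which
  is finite by compactness. These points are corrected one at a time: a flip at \<open>x\<close>
  comes from a flip at some \<open>n\<close> with \<open>y n = x\<close>.\<close>

lemma acc_eq_G_lift:
  fixes e f :: "'a \<Rightarrow>\<^sub>C real"
  assumes e: "e \<in> unimodular" and f: "f \<in> unimodular" and acc: "acc_eq f (G e)"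
  shows "\<exists>d\<in>unimodular. acc_eq d e \<and> G d = f"
proof -
  have "finite {x. f x \<noteq> G e x}"
  proof (rule closed_isolated_finite)
    have "{x. f x \<noteq> G e x} = {x. f x * G e x \<le> 0}"
    proof (rule Collect_cong)
      fix x
      show "f x \<noteq> G e x \<longleftrightarrow> f x * G e x \<le> 0"
        using unimodularD[OF f, of x] unimodularD[OF G_unimodular[OF e], of x] by auto
    qed
    also have "closed \<dots>"
      by (intro closed_Collect_le continuous_intros) auto
    finally show "closed {x. f x \<noteq> G e x}" .
  qed (use acc in \<open>auto simp: acc_eq_def\<close>)
  moreover have "\<exists>d\<in>unimodular. acc_eq d e \<and> G d = g"
    if "finite D" "D = {x. g x \<noteq> G e x}" "g \<in> unimodular" "\<And>x. x \<in> D \<Longrightarrow> open {x}"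
    for D and g :: "'a \<Rightarrow>\<^sub>C real"
    using that
  proof (induction D arbitrary: g rule: finite_induct)
    case empty
    then have "g = G e" by (intro bcontfun_eqI) auto
    then show ?case using e by (auto simp: acc_eq_def)
  next
    case (insert x D)
    have x: "open {x}" using insert.prems by auto
    have gx: "g x \<noteq> G e x" using insert.prems(1) by auto
    have "flip x g z \<noteq> G e z \<longleftrightarrow> z \<in> D" for z
    proof (cases "z = x")
      case True
      then show ?thesis
        using gx insert.hyps(2) unimodularD[OF insert.prems(2), of x]
          unimodularD[OF G_unimodular[OF e], of x] by (auto simp: flip_apply[OF x])
    next
      case False
      then have "z \<in> D \<longleftrightarrow> z \<in> insert x D" by simp
      then show ?thesis using False by (simp add: insert.prems(1) flip_apply[OF x])
    qed
    then obtain d where d: "d \<in> unimodular" "acc_eq d e" "G d = flip x g"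
      using insert.IH[of "flip x g"] flip_unimodular[OF x insert.prems(2)] insert.prems(3) by blast
    obtain n where n: "open {n}" "y n = x" using y_surj[OF x] by blast
    have "G (flip n d) = flip x (flip x g)"
      using G_flip[OF d(1) n(1)] n(2) d(3) by simp
    also have "\<dots> = g"
      by (rule bcontfun_eqI) (simp add: flip_apply[OF x])
    finally have "G (flip n d) = g" .
    moreover have "acc_eq (flip n d) e"
      using d(2) n(1) by (auto simp: acc_eq_def flip_apply[OF n(1)])
    ultimately show ?case
      using flip_unimodular[OF n(1) d(1)] by blast
  qed
  ultimately show ?thesis
    using f acc by (auto simp: acc_eq_def)
qed

text \<open>Lifting \<open>G d\<close> gives a preimage with the pattern of \<open>e\<close>; since
  \<open>G\<close> is injective on the ball, it is \<open>d\<close> itself.\<close>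

lemma acc_eq_G_cancel:
  assumes "e \<in> unimodular" "d \<in> unimodular" "acc_eq (G d) (G e)"
  shows "acc_eq d e"
proof -
  obtain k where "k \<in> unimodular" "acc_eq k e" "G k = G d"
    using acc_eq_G_lift[OF assms(1) G_unimodular[OF assms(2)] assms(3)] by blast
  then show ?thesis
    using assms(2) F_G unimodular_in_cball by metis
qed

text \<open>There are finitely many sign patterns on the accumulation points, so two iterates of f under G share
  one; cancelling G shows that f has the pattern of a function in the range of G.\<close>
lemma G_surj_unimodular:
  assumes f: "f \<in> unimodular"
  obtains e where "e \<in> unimodular" "G e = f"
proof -
  define A where "A = {x::'a. \<not> open {x}}"
  define p where "p k = restrict ((G ^^ k) f) A" for k
  have it: "(G ^^ k) f \<in> unimodular" for k
    by (induction k) (auto simp: f G_unimodular)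
  have "p k \<in> A \<rightarrow>\<^sub>E {1, -1}" for k
    using unimodularD[OF it] by (auto simp: p_def)
  then have "finite (range p)"
    using finite_PiE[of A "\<lambda>_. {1, -1::real}"] finite_acc
    by (intro finite_subset[of "range p" "A \<rightarrow>\<^sub>E {1, -1}"]) (auto simp: A_def)
  then have "\<not> inj p"
    using finite_imageD infinite_UNIV_nat by blast
  then obtain i j where ij: "i < j" "p i = p j"
    unfolding inj_def by (metis linorder_neqE_nat)
  define l where "l = j - i"
  have "acc_eq ((G ^^ i) f) ((G ^^ (i + l)) f)"
    unfolding acc_eq_def
  proof (intro allI impI)
    fix x :: 'a assume "\<not> open {x}"
    then have "x \<in> A" by (simp add: A_def)
    then show "(G ^^ i) f x = (G ^^ (i + l)) f x"
      using fun_cong[OF ij(2), of x] ij(1) by (simp add: p_def l_def)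
  qed
  then have "acc_eq f ((G ^^ l) f)"
  proof (induction i)
    case (Suc i)
    then show ?case using acc_eq_G_cancel[OF it it] by simp
  qed simp
  moreover obtain k where "l = Suc k"
    using ij(1) by (metis l_def not0_implies_Suc zero_less_diff less_irrefl)
  then have "(G ^^ l) f = G ((G ^^ k) f)" by simp
  ultimately show thesis
    using acc_eq_G_lift[OF it f] that by metis
qed

end

text \<open>The data \<open>y\<close> and \<open>\<epsilon>\<close> are arguments so that
  \<open>F\<close> and its rescaled restrictions can be shown to share them. Only isolated points
  matter, since they are dense.\<close>

definition represents ::
    "(('a::topological_space \<Rightarrow>\<^sub>C real) \<Rightarrow> ('a \<Rightarrow>\<^sub>C real)) \<Rightarrow> ('a \<Rightarrow> 'a) \<Rightarrow> ('a \<Rightarrow> real) \<Rightarrow> bool" where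
  "represents F y \<epsilon> \<longleftrightarrow>
    (\<forall>n. open {n} \<longrightarrow> open {y n} \<and> \<bar>\<epsilon> n\<bar> = 1) \<and>
    (\<forall>x. open {x} \<longrightarrow> (\<exists>n. open {n} \<and> y n = x)) \<and>
    (\<forall>f\<in>unimodular. F f \<in> unimodular \<and> (\<forall>n. open {n} \<longrightarrow> F f n = \<epsilon> n * f (y n)))"

section \<open>Representation on unimodular functions and restriction to sub-balls\<close>

context nonexpansive_ball_bijection
begin

lemma representation_exists: "\<exists>y \<epsilon>. represents F y \<epsilon>"
proof -
  define \<epsilon> where "\<epsilon> n = G (const_bcontfun 1) (y n)" for n
  have \<epsilon>: "\<epsilon> n = 1 \<or> \<epsilon> n = -1" for n
    unfolding \<epsilon>_def by (rule unimodularD[OF G_unimodular[OF one_unimodular]])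
  have "F f \<in> unimodular \<and> (\<forall>n. open {n} \<longrightarrow> F f n = \<epsilon> n * f (y n))" if f: "f \<in> unimodular" for f
  proof -
    obtain e where e: "e \<in> unimodular" "G e = f" using G_surj_unimodular[OF f] .
    have "F f = e" using e F_G unimodular_in_cball by blast
    moreover have "e n = \<epsilon> n * f (y n)" if "open {n}" for n
      using G_apply_y[OF e(1) that] \<epsilon>[of n] by (auto simp: e(2) \<epsilon>_def)
    ultimately show ?thesis using e(1) by simp
  qed
  moreover have "\<bar>\<epsilon> n\<bar> = 1" for n using \<epsilon>[of n] by auto
  ultimately have "represents F y \<epsilon>"
    unfolding represents_def using y y_surj by metis
  then show ?thesis by blast
qed

lemma F_lower_bound':
  fixes f u :: "'a \<Rightarrow>\<^sub>C real"
  assumes "represents F \<sigma> \<epsilon>" "f \<in> unimodular" "u \<in> cball 0 1" "\<And>x. s \<le> f x * u x"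
  shows "s \<le> F f z * F u z"
proof (rule F_lower_bound[OF _ assms(3)])
  show "F f \<in> unimodular" using assms(1,2) by (auto simp: represents_def)
  show "s \<le> G (F f) x * u x" for x
    using assms(4) G_F[OF unimodular_in_cball[OF assms(2)]] by simp
qed

text \<open>With \<open>s\<close> nearly the sign of \<open>u\<close>, both \<open>s\<close> and its
  flip at \<open>\<sigma> n\<close> have product at least \<open>- M\<close> with \<open>u\<close>.
  Their images have opposite signs at \<open>n\<close>, so the two lower bounds bound
  \<open>F u n\<close> from both sides.\<close>

lemma F_abs_le:
  assumes rep: "represents F \<sigma> \<epsilon>" and u: "u \<in> cball 0 1" and n: "open {n}"
  shows "\<bar>F u n\<bar> \<le> \<bar>u (\<sigma> n)\<bar>"
proof (rule field_le_epsilon)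
  fix \<delta> :: real assume "0 < \<delta>"
  then obtain c s where c: "0 < c" "c < \<delta>" and s: "s \<in> unimodular"
      "\<And>x. s x = (if c < u x then 1 else -1)"
    using threshold_sign[of \<delta> u] by metis
  have x: "open {\<sigma> n}" using rep n by (simp add: represents_def)
  define M where "M = \<bar>u (\<sigma> n)\<bar> + \<delta>"
  have fl: "flip (\<sigma> n) s \<in> unimodular" by (rule flip_unimodular[OF x s(1)])
  have "- M \<le> F s n * F u n"
    by (rule F_lower_bound'[OF rep s(1) u]) (use c in \<open>auto simp: s(2) M_def\<close>)
  moreover have "- M \<le> F (flip (\<sigma> n) s) n * F u n"
    by (rule F_lower_bound'[OF rep fl u]) (use c in \<open>auto simp: flip_apply[OF x] s(2) M_def\<close>)
  moreover have "F (flip (\<sigma> n) s) n = - F s n"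
    using rep n s(1) fl by (simp add: represents_def flip_apply[OF x])
  moreover have "F s n = 1 \<or> F s n = -1"
    using rep s(1) by (intro unimodularD) (simp add: represents_def)
  ultimately show "\<bar>F u n\<bar> \<le> \<bar>u (\<sigma> n)\<bar> + \<delta>"
    unfolding M_def by auto
qed

text \<open>F maps the ball of functions u with f u \<open>\<ge>\<close> a bijectively onto the corresponding ball around a
  multiple of F f; rescaling these balls to the unit ball gives a map of the same kind.\<close>
lemma rescaled_sub_ball:
  fixes f :: "'a \<Rightarrow>\<^sub>C real" and a :: real
  assumes rep: "represents F \<sigma> \<epsilon>" and f: "f \<in> unimodular" and a: "0 < a" "a < 1"
  defines "c \<equiv> (1 + a) / 2" and "r \<equiv> (1 - a) / 2"
  defines "\<Phi> \<equiv> \<lambda>g. (1 / r) *\<^sub>R (F (c *\<^sub>R f + r *\<^sub>R g) - c *\<^sub>R F f)"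
  shows "nonexpansive_ball_bijection \<Phi>" and "represents \<Phi> \<sigma> \<epsilon>"
proof -
  have cr: "c + r = 1" "c - r = a" "0 < r" "0 < c"
    using a by (auto simp: c_def r_def field_simps)
  have f1: "f x = 1 \<or> f x = -1" for x by (rule unimodularD[OF f])
  have Ff: "F f \<in> unimodular" using rep f by (simp add: represents_def)
  have e1: "F f x = 1 \<or> F f x = -1" for x by (rule unimodularD[OF Ff])
  define U where "U g = c *\<^sub>R f + r *\<^sub>R g" for g
  have \<Phi>: "\<Phi> g = (1 / r) *\<^sub>R (F (U g) - c *\<^sub>R F f)" for g
    by (simp add: \<Phi>_def U_def)
  \<comment> \<open>The interval [a, 1] has centre \<open>c\<close> and radius \<open>r\<close>, so
    the conditions describe the ball of radius \<open>r\<close> around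
    \<open>c *\<^sub>R q\<close>.\<close>
  have ball: "(\<forall>x. \<bar>p x\<bar> \<le> 1 \<and> a \<le> q x * p x) \<longleftrightarrow> (1 / r) *\<^sub>R (p - c *\<^sub>R q) \<in> cball 0 1"
    if q: "\<And>x. q x = 1 \<or> q x = -1" for p q :: "'a \<Rightarrow>\<^sub>C real"
  proof -
    have "\<bar>p x\<bar> \<le> 1 \<and> a \<le> q x * p x \<longleftrightarrow> \<bar>p x - c * q x\<bar> \<le> r" for x
      using q[of x] cr by auto
    then show ?thesis
      using cr(3) by (simp add: norm_bcontfun_le_iff abs_mult field_simps)
  qed
  have U_inv: "(1 / r) *\<^sub>R (U g - c *\<^sub>R f) = g" for g
    using cr by (simp add: U_def)
  have U: "U g \<in> cball 0 1" "a \<le> f x * U g x" if "g \<in> cball 0 1" for g x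
    using ball[OF f1, of "U g"] that by (auto simp: U_inv norm_bcontfun_le_iff)
  have maps: "\<Phi> g \<in> cball 0 1" if g: "g \<in> cball 0 1" for g
  proof -
    have "\<bar>F (U g) x\<bar> \<le> 1" for x
      using F_cball[OF U(1)[OF g]] by (simp add: norm_bcontfun_le_iff)
    moreover have "a \<le> F f x * F (U g) x" for x
      by (rule F_lower_bound'[OF rep f U(1)[OF g] U(2)[OF g]])
    ultimately show ?thesis
      using ball[OF e1, of "F (U g)"] by (simp add: \<Phi>)
  qed
  have surj: "\<exists>g\<in>cball 0 1. \<Phi> g = h" if h: "h \<in> cball 0 1" for h
  proof -
    define v where "v = c *\<^sub>R F f + r *\<^sub>R h"
    have hv: "(1 / r) *\<^sub>R (v - c *\<^sub>R F f) = h" using cr by (simp add: v_def)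
    then have v: "v \<in> cball 0 1" "\<And>x. a \<le> F f x * v x"
      using ball[OF e1, of v] h by (auto simp: norm_bcontfun_le_iff)
    define u where "u = G v"
    have u: "u \<in> cball 0 1" "F u = v"
      unfolding u_def by (rule G_cball[OF v(1)], rule F_G[OF v(1)])
    \<comment> \<open>The lower bound on \<open>v\<close> at \<open>n\<close> passes to
      \<open>u\<close> at \<open>\<sigma> n\<close>, and \<open>\<sigma>\<close> reaches all
      isolated points.\<close>
    have ua: "a \<le> \<bar>u x\<bar>" for x
    proof (rule le_if_le_on_isolated[where h = "\<lambda>_. a" and k = "\<lambda>x. \<bar>u x\<bar>"])
      fix x :: 'a assume "open {x}"
      then obtain n where n: "open {n}" "\<sigma> n = x"
        using rep by (auto simp: represents_def)
      have "a \<le> \<bar>v n\<bar>" using v(2)[of n] e1[of n] by auto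
      then show "a \<le> \<bar>u x\<bar>" using F_abs_le[OF rep u(1) n(1)] by (simp add: u(2) n(2))
    qed (auto intro!: continuous_intros)
    define s where "s = Bcontfun (\<lambda>x. u x / \<bar>u x\<bar>)"
    have unz: "u x \<noteq> 0" for x using ua[of x] a by auto
    have "continuous_on UNIV (\<lambda>x. u x / \<bar>u x\<bar>)"
      using unz by (intro continuous_intros) auto
    then have s: "s x = u x / \<bar>u x\<bar>" for x
      by (simp add: s_def apply_Bcontfun)
    have s_uni: "s \<in> unimodular" using unz by (simp add: unimodular_def s)
    have su: "a \<le> s x * u x" for x
      using ua[of x] unz[of x] by (auto simp: s abs_if split: if_splits)
    \<comment> \<open>Both sides are the sign of \<open>v\<close>, so \<open>u\<close> has sign
      \<open>f\<close> and lies in the required sub-ball.\<close>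
    have "F s = F f"
    proof (rule bcontfun_eqI)
      fix x
      have "a \<le> F s x * v x"
        using F_lower_bound'[OF rep s_uni u(1) su] by (simp add: u(2))
      moreover have "F s x = 1 \<or> F s x = -1"
        using rep s_uni by (intro unimodularD) (simp add: represents_def)
      ultimately show "F s x = F f x"
        using v(2)[of x] e1[of x] a by auto
    qed
    then have "s = f"
      by (rule F_inj[OF unimodular_in_cball[OF s_uni] unimodular_in_cball[OF f]])
    define g where "g = (1 / r) *\<^sub>R (u - c *\<^sub>R f)"
    have "g \<in> cball 0 1"
      using ball[OF f1, of u] u(1) su \<open>s = f\<close> by (auto simp: g_def norm_bcontfun_le_iff)
    moreover have "U g = u" using cr by (simp add: U_def g_def)
    then have "\<Phi> g = h" by (simp add: \<Phi> u(2) hv)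
    ultimately show ?thesis by blast
  qed
  have "inj_on \<Phi> (cball 0 1)"
  proof (rule inj_onI)
    fix g h assume gh: "g \<in> cball 0 1" "h \<in> cball 0 1" "\<Phi> g = \<Phi> h"
    then have "F (U g) = F (U h)" using cr by (simp add: \<Phi>)
    then have "U g = U h" by (rule F_inj[OF U(1)[OF gh(1)] U(1)[OF gh(2)]])
    then show "g = h" by (metis U_inv)
  qed
  moreover have "\<Phi> ` cball 0 1 = cball 0 1"
    using maps surj by (blast intro: sym)
  ultimately have bij\<Phi>: "bij_betw \<Phi> (cball 0 1) (cball 0 1)" by (simp add: bij_betw_def)
  show nb: "nonexpansive_ball_bijection \<Phi>"
  proof (unfold_locales, rule bij\<Phi>)
    fix g h :: "'a \<Rightarrow>\<^sub>C real" assume gh: "g \<in> cball 0 1" "h \<in> cball 0 1"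
    have "\<Phi> g - \<Phi> h = (1 / r) *\<^sub>R (F (U g) - F (U h))"
      by (simp add: \<Phi> algebra_simps)
    then have "dist (\<Phi> g) (\<Phi> h) = (1 / r) * dist (F (U g)) (F (U h))"
      using cr by (simp add: dist_norm)
    also have "\<dots> \<le> (1 / r) * dist (U g) (U h)"
      using cr nonexp[OF U(1)[OF gh(1)] U(1)[OF gh(2)]] by (intro mult_left_mono) auto
    also have "U g - U h = r *\<^sub>R (g - h)"
      by (simp add: U_def algebra_simps)
    then have "(1 / r) * dist (U g) (U h) = dist g h"
      using cr by (simp add: dist_norm)
    finally show "dist (\<Phi> g) (\<Phi> h) \<le> dist g h" .
  qed
  \<comment> \<open>It remains to identify these data with the given ones, using that the rescaling
    fixes \<open>f\<close>.\<close>
  then obtain \<sigma>' \<epsilon>' where rep': "represents \<Phi> \<sigma>' \<epsilon>'"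
    using nonexpansive_ball_bijection.representation_exists by blast
  have "U f = f" using cr by (simp add: U_def flip: scaleR_add_left)
  then have \<Phi>f: "\<Phi> f n = F f n" for n
    using cr e1[of n] by (auto simp: \<Phi> field_simps)
  have "\<sigma>' n = \<sigma> n \<and> \<epsilon>' n = \<epsilon> n" if n: "open {n}" for n
  proof -
    have x: "open {\<sigma> n}" using rep n by (simp add: represents_def)
    \<comment> \<open>If \<open>\<sigma>' n\<close> were another point, \<open>\<Phi>\<close> would
      not notice this flip at \<open>n\<close>, giving \<open>F (U g) n\<close> absolute value 1,
      whereas \<open>U g\<close> has absolute value \<open>a\<close> < 1 at
      \<open>\<sigma> n\<close>.\<close>
    define g where "g = flip (\<sigma> n) f"
    have g: "g \<in> unimodular" unfolding g_def by (rule flip_unimodular[OF x f])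
    have \<epsilon>': "\<epsilon>' n * f (\<sigma>' n) = F f n"
      using rep' f n \<Phi>f[of n] by (simp add: represents_def)
    have \<epsilon>: "\<epsilon> n * f (\<sigma> n) = F f n"
      using rep f n by (simp add: represents_def)
    have "\<sigma>' n = \<sigma> n"
    proof (rule ccontr)
      assume "\<sigma>' n \<noteq> \<sigma> n"
      then have "\<Phi> g n = F f n"
        using rep' g n \<epsilon>' by (simp add: represents_def g_def flip_apply[OF x])
      then have "F (U g) n = (c + r) * F f n"
        using cr(3) by (simp add: \<Phi> field_simps)
      moreover have "\<bar>F (U g) n\<bar> \<le> \<bar>U g (\<sigma> n)\<bar>"
        by (rule F_abs_le[OF rep U(1)[OF unimodular_in_cball[OF g]] n])
      moreover have "U g (\<sigma> n) = (c - r) * f (\<sigma> n)"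
        by (simp add: U_def g_def flip_apply[OF x] algebra_simps)
      ultimately show False
        using cr e1[of n] f1[of "\<sigma> n"] a by auto
    qed
    then show ?thesis using \<epsilon> \<epsilon>' f1[of "\<sigma> n"] by auto
  qed
  then show "represents \<Phi> \<sigma> \<epsilon>"
    using rep rep' by (simp add: represents_def)
qed

end

section \<open>Plasticity\<close>

text \<open>Passing to a sub-ball of radius r < 1/2 scales the error by r, so any uniform bound can be halved.\<close>
lemma representation_error:
  fixes F :: "('a::topological_space \<Rightarrow>\<^sub>C real) \<Rightarrow> ('a \<Rightarrow>\<^sub>C real)"
  assumes "nonexpansive_ball_bijection F" "represents F \<sigma> \<epsilon>" "u \<in> cball 0 1" "open {n}"
  shows "\<bar>F u n - \<epsilon> n * u (\<sigma> n)\<bar> \<le> 2 / 2 ^ k"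
  using assms
\<comment> \<open>\<open>F\<close> is generalised because the induction hypothesis is applied to the
  rescaled map.\<close>
proof (induction k arbitrary: F u)
  case 0
  interpret nonexpansive_ball_bijection F by fact
  have "\<bar>F u n\<bar> \<le> 1" "\<bar>u (\<sigma> n)\<bar> \<le> 1"
    using F_cball[OF "0.prems"(3)] "0.prems"(3) by (auto simp: norm_bcontfun_le_iff)
  moreover have "\<bar>\<epsilon> n * u (\<sigma> n)\<bar> = \<bar>u (\<sigma> n)\<bar>"
    using "0.prems" by (simp add: represents_def abs_mult)
  ultimately show ?case by simp
next
  case (Suc k)
  interpret nonexpansive_ball_bijection F by fact
  note rep = Suc.prems(2) and u = Suc.prems(3) and n = Suc.prems(4)
  have \<epsilon>: "\<bar>\<epsilon> n\<bar> = 1" using rep n by (simp add: represents_def)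
  show ?case
  proof (rule field_le_epsilon)
    fix \<delta> :: real assume "0 < \<delta>"
    \<comment> \<open>\<open>u\<close> may vanish or come arbitrarily close to 0, so a nearby
      \<open>w\<close> lying in a sub-ball replaces it.\<close>
    then obtain a s w where a: "0 < a" "a < 1" and s: "s \<in> unimodular"
        and w: "w \<in> cball 0 1" "dist w u \<le> \<delta> / 2" "\<And>x. a \<le> s x * w x"
      using nonvanishing_approx[OF u, of "\<delta> / 2"] by (metis half_gt_zero)
    define c r where "c = (1 + a) / 2" and "r = (1 - a) / 2"
    have r: "0 < r" "r \<le> 1 / 2" "c + r = 1" "c - r = a"
      using a by (auto simp: c_def r_def field_simps)
    define \<Phi> where "\<Phi> = (\<lambda>g. (1 / r) *\<^sub>R (F (c *\<^sub>R s + r *\<^sub>R g) - c *\<^sub>R F s))"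
    have \<Phi>: "nonexpansive_ball_bijection \<Phi>" "represents \<Phi> \<sigma> \<epsilon>"
      using rescaled_sub_ball[OF rep s a] by (simp_all add: \<Phi>_def c_def r_def)
    define g where "g = (1 / r) *\<^sub>R (w - c *\<^sub>R s)"
    have "\<bar>w x - c * s x\<bar> \<le> r" for x
    proof -
      have "\<bar>w x\<bar> \<le> 1" using w(1) by (simp add: norm_bcontfun_le_iff)
      then show ?thesis using w(3)[of x] unimodularD[OF s, of x] r by auto
    qed
    then have g: "g \<in> cball 0 1"
      using r(1) by (simp add: g_def norm_bcontfun_le_iff abs_mult field_simps)
    have "c *\<^sub>R s + r *\<^sub>R g = w" using r by (simp add: g_def)
    then have "\<Phi> g n = (F w n - c * F s n) / r" by (simp add: \<Phi>_def)
    moreover have "F s n = \<epsilon> n * s (\<sigma> n)"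
      using rep s n by (simp add: represents_def)
    \<comment> \<open>The formula is exact at the centre of the sub-ball, so only \<open>r\<close>
      times the error of \<open>\<Phi>\<close> at \<open>g\<close> remains.\<close>
    ultimately have "F w n - \<epsilon> n * w (\<sigma> n) = r * (\<Phi> g n - \<epsilon> n * g (\<sigma> n))"
      using r(1) by (simp add: g_def field_simps)
    then have "\<bar>F w n - \<epsilon> n * w (\<sigma> n)\<bar> = r * \<bar>\<Phi> g n - \<epsilon> n * g (\<sigma> n)\<bar>"
      using r(1) by (simp add: abs_mult)
    also have "\<dots> \<le> 1 / 2 * (2 / 2 ^ k)"
      using r Suc.IH[OF \<Phi> g n] by (intro mult_mono) auto
    finally have "\<bar>F w n - \<epsilon> n * w (\<sigma> n)\<bar> \<le> 2 / 2 ^ Suc k" by simp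
    moreover have "\<bar>F w n - F u n\<bar> \<le> \<delta> / 2"
      using F_pointwise_nonexp[OF w(1) u] w(2) unfolding dist_bcontfun_le_iff by blast
    moreover have "\<bar>\<epsilon> n * w (\<sigma> n) - \<epsilon> n * u (\<sigma> n)\<bar> \<le> \<delta> / 2"
    proof -
      have "\<bar>w (\<sigma> n) - u (\<sigma> n)\<bar> \<le> \<delta> / 2"
        using w(2) unfolding dist_bcontfun_le_iff by blast
      then show ?thesis using \<epsilon> by (simp add: abs_mult flip: right_diff_distrib)
    qed
    ultimately show "\<bar>F u n - \<epsilon> n * u (\<sigma> n)\<bar> \<le> 2 / 2 ^ Suc k + \<delta>" by linarith
  qed
qed

text \<open>Letting k tend to infinity gives \<open>F u n = \<epsilon> n * u (\<sigma> n)\<close>.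
  As \<open>\<sigma>\<close> is onto the dense set of isolated points, no distance shrinks.\<close>

lemma (in nonexpansive_ball_bijection) isometry:
  assumes f: "f \<in> cball 0 1" and g: "g \<in> cball 0 1"
  shows "dist (F f) (F g) = dist f g"
proof (rule antisym[OF nonexp[OF f g]])
  obtain \<sigma> \<epsilon> where rep: "represents F \<sigma> \<epsilon>" using representation_exists by blast
  have formula: "F u n = \<epsilon> n * u (\<sigma> n)" if "u \<in> cball 0 1" "open {n}" for u n
  proof -
    have "(\<lambda>k. 2 / 2 ^ k :: real) \<longlonglongrightarrow> 0"
      using tendsto_mult_right_zero[OF LIMSEQ_power_zero[of "1 / 2 :: real"], of 2]
      by (simp add: power_divide)
    then have "\<bar>F u n - \<epsilon> n * u (\<sigma> n)\<bar> \<le> 0"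
      using representation_error[OF nonexpansive_ball_bijection_axioms rep that]
      by (intro LIMSEQ_le_const) auto
    then show ?thesis by simp
  qed
  have "\<bar>f x - g x\<bar> \<le> dist (F f) (F g)" for x
  proof (rule le_if_le_on_isolated[where k = "\<lambda>_. dist (F f) (F g)"])
    fix x :: 'a assume "open {x}"
    then obtain n where n: "open {n}" "\<sigma> n = x" using rep by (auto simp: represents_def)
    then have "\<bar>\<epsilon> n\<bar> = 1" using rep by (simp add: represents_def)
    then have "\<bar>f x - g x\<bar> = \<bar>F f n - F g n\<bar>"
      by (simp add: formula[OF f n(1)] formula[OF g n(1)] n(2) abs_mult flip: right_diff_distrib)
    also have "\<dots> \<le> dist (F f) (F g)"
      using dist_bounded[of "F f" n "F g"] by (simp add: dist_real_def)
    finally show "\<bar>f x - g x\<bar> \<le> dist (F f) (F g)" .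
  qed (auto intro!: continuous_intros)
  then show "dist f g \<le> dist (F f) (F g)" by (simp add: dist_bcontfun_le_iff)
qed

theorem theorem1p1:
  fixes F :: "('a::topological_space \<Rightarrow>\<^sub>C real) \<Rightarrow> ('a \<Rightarrow>\<^sub>C real)"
  assumes "metrizable_space (euclidean :: 'a topology)"
    and "compact_space (euclidean :: 'a topology)"
    and "finite {x :: 'a. x islimpt UNIV}"
    and "bij_betw F (cball 0 1) (cball 0 1)"
    and "\<forall>f\<in>cball 0 1. \<forall>g\<in>cball 0 1. dist (F f) (F g) \<le> dist f g"
  shows "\<forall>f\<in>cball 0 1. \<forall>g\<in>cball 0 1. dist (F f) (F g) = dist f g"
proof -
  interpret nonexpansive_ball_bijection F
  proof
    show "compact (UNIV :: 'a set)"
      using assms(2) by (simp add: compact_space_def)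
    show "closed {x}" for x :: 'a
      using metrizable_imp_t1_space[OF assms(1)] by (simp add: t1_space_closedin_singleton)
    show "finite {x :: 'a. \<not> open {x}}"
      using assms(3) by (simp add: islimpt_UNIV_iff)
  qed (use assms(4,5) in blast)+
  show ?thesis using isometry by blast
qed

end
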